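(* For $y>0$ let $$T(y)=\frac16\Big[\frac1y+8\,{}_2F_1(3,1;4;1-y)-6\,{}_2F_1(4,1;5;1-y)-3y\,{}_2F_1(4,2;5;1-y)\Big].$$ Then $$T(y)=K(1)\Big(y^{-1}-{}_2F_1(3,1;5;1-y)\Big),$$ where $K(1)=K_{\Delta_k}(1;2)=\frac16$. Moreover, $T$ satisfies the functional equation $$T(y)+y^{-2}T(y^{-1})=0 .$$
   Context: ${}_2F_1(a,b;c;z)=\frac{\Gamma(c)}{\Gamma(b)\Gamma(c-b)}\int_0^1(1-t)^{c-b-1}t^{b-1}(1-zt)^{-a}\,dt$ is the Gauss hypergeometric function (for $c>b>0$, $z<1$). The function $K_{\Delta_k}(\cdot;2)$ is $K_{\Delta_k}(y;2)=-\frac12\,{}_2F_1(2,1;3;1-y)+\frac23\,{}_2F_1(3,1;4;1-y)$. *)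

theory Defs
  imports "HOL-Analysis.Analysis"
begin

text \<open>
  Euler's integral representation, meaningful for \<open>c > b > 0\<close> and \<open>z < 1\<close>; then all bases
  are nonnegative on \<open>[0,1]\<close>. The convention \<open>0 powr x = 0\<close> affects the integrand only at
  the two endpoints, hence not the integral.
\<close>
definition hyp2F1 :: "real \<Rightarrow> real \<Rightarrow> real \<Rightarrow> real \<Rightarrow> real" where
  "hyp2F1 a b c z =
     Gamma c / (Gamma b * Gamma (c - b)) *
     integral {0..1} (\<lambda>t. (1 - t) powr (c - b - 1) * t powr (b - 1) * (1 - z * t) powr (- a))"

text \<open>The one-variable function written K_{Delta_k}(y; 2), with the parameter 2 built in.\<close>
definition K_Delta_2 :: "real \<Rightarrow> real" where
  "K_Delta_2 y = - (1/2) * hyp2F1 2 1 3 (1 - y) + (2/3) * hyp2F1 3 1 4 (1 - y)"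

definition T :: "real \<Rightarrow> real" where
  "T y = (1/6) * (1 / y + 8 * hyp2F1 3 1 4 (1 - y) - 6 * hyp2F1 4 1 5 (1 - y)
                    - 3 * y * hyp2F1 4 2 5 (1 - y))"

end

theory Submission
  imports Defs
begin

text \<open>
  Write \<open>D = 1 - t + y * t\<close>, the affine function with \<open>D = 1\<close> at \<open>t = 0\<close> and \<open>D = y\<close> at
  \<open>t = 1\<close>. For integer parameters Euler's integral turns every hypergeometric value below into
  the integral over \<open>[0,1]\<close> of a rational function of \<open>t\<close> with a power of \<open>D\<close> as denominator
  (\<open>hyp2F1_one_minus_eq_integral\<close>), so both identities become statements about such integrals.

  For the closed form, the relation \<open>D = (1 - t) + y * t\<close> gives
  \<open>(1-t)\<^sup>2 / D^3 = (1-t)^3 / D^4 + y * (1-t)\<^sup>2 * t / D^4\<close>. The three hypergeometric terms of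
  \<open>6 * T y\<close> therefore collapse to \<open>-12 * y\<close> times the integral of \<open>(1-t)\<^sup>2 * t / D^4\<close>.
  With \<open>u = (1-t) / D\<close> one has \<open>u' = - y / D\<^sup>2\<close>, so \<open>3 * y * (1-t)\<^sup>2 * t / D^4 = - t * (u^3)'\<close>,
  and integration by parts turns its integral into that of \<open>u^3\<close>
  (\<open>integral_by_parts_cube\<close>), which is a multiple of \<open>hyp2F1 3 1 5 (1 - y)\<close>.

  For the functional equation, the substitution \<open>t \<mapsto> 1 - t\<close> writes \<open>hyp2F1 3 1 5 (1 - 1/y)\<close>
  as \<open>4 * y^3\<close> times the integral of \<open>(t / D)^3\<close> (\<open>integral_reflect_cube\<close>). What remains is
  that \<open>((1-t)^3 + y * t^3) / D^3\<close> has integral \<open>1 / (2 * y)\<close>. For \<open>y \<noteq> 1\<close> each of its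
  two parts integrates to an expression containing \<open>ln y\<close>, but the logarithms cancel in the sum,
  which has a rational antiderivative (\<open>integral_cubes\<close>).
\<close>

section \<open>Euler's integral for integer parameters\<close>

lemma interpolation_pos:
  fixes y t :: real
  assumes "y > 0" "0 \<le> t" "t \<le> 1"
  shows "1 - t + y * t > 0"
  using assms by (cases "t = 1") (auto intro: add_pos_nonneg)

lemma interpolant_integrable:
  fixes y :: real
  assumes "y > 0"
  shows "(\<lambda>t. (1 - t) ^ m * t ^ n / (1 - t + y * t) ^ a) integrable_on {0..1}"
  by (intro integrable_continuous_real continuous_intros)
     (use interpolation_pos[OF assms] in force)

lemma integral_add_scaled:
  fixes f g :: "real \<Rightarrow> real"
  assumes "f integrable_on S" "g integrable_on S"
  shows "integral S (\<lambda>t. f t + c * g t) = integral S f + c * integral S g"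
  using assms by (subst integral_add) (auto intro: integrable_on_mult_right)

text \<open>
  The real powers in the definition agree with the integer powers except at the endpoints, where
  \<open>0 powr 0 = 0\<close> but \<open>0 ^ 0 = 1\<close>; two points do not affect the integral.
\<close>
lemma hyp2F1_one_minus_eq_integral:
  fixes y :: real and a b c :: nat
  assumes "y > 0"
  shows "hyp2F1 (real a) (real (Suc b)) (real (b + c + 2)) (1 - y) =
    fact (b + c + 1) / (fact b * fact c) *
    integral {0..1} (\<lambda>t. (1 - t) ^ c * t ^ b / (1 - t + y * t) ^ a)"
proof -
  have "(1 - t) powr (real (b + c + 2) - real (Suc b) - 1) * t powr (real (Suc b) - 1) *
        (1 - (1 - y) * t) powr (- real a)
      = (1 - t) ^ c * t ^ b / (1 - t + y * t) ^ a" if t: "t \<in> {0..1} - {0,1}" for t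
  proof -
    have "1 - (1 - y) * t = 1 - t + y * t"
      by (simp add: algebra_simps)
    moreover have "1 - t + y * t > 0"
      using interpolation_pos[OF assms] t by auto
    ultimately show ?thesis
      using t by (simp add: powr_minus powr_realpow field_simps)
  qed
  then have "integral {0..1} (\<lambda>t. (1 - t) powr (real (b + c + 2) - real (Suc b) - 1) *
        t powr (real (Suc b) - 1) * (1 - (1 - y) * t) powr (- real a))
      = integral {0..1} (\<lambda>t. (1 - t) ^ c * t ^ b / (1 - t + y * t) ^ a)"
    by (intro integral_spike[of "{0,1}"]) auto
  moreover have "Gamma (real (b + c + 2)) = fact (b + c + 1)"
    using Gamma_fact[of "b + c + 1", where 'a = real] by (simp add: algebra_simps)
  moreover have "Gamma (real (Suc b)) = fact b"
    using Gamma_fact[of b, where 'a = real] by (simp add: algebra_simps)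
  moreover have "Gamma (real (b + c + 2) - real (Suc b)) = fact c"
    using Gamma_fact[of c, where 'a = real] by (simp add: algebra_simps)
  ultimately show ?thesis
    unfolding hyp2F1_def by simp
qed

text \<open>At \<open>z = 0\<close> Euler's integral is the Beta integral, and the prefactor normalises it.\<close>
lemma hyp2F1_zero:
  assumes "0 < b" "b < c"
  shows "hyp2F1 a b c 0 = 1"
proof -
  have "((\<lambda>t. t powr (b - 1) * (1 - t) powr (c - b - 1)) has_integral Beta b (c - b)) {0..1}"
    using assms by (intro has_integral_Beta_real) auto
  then have "integral {0..1} (\<lambda>t. t powr (b - 1) * (1 - t) powr (c - b - 1)) = Beta b (c - b)"
    by (rule integral_unique)
  moreover have "Gamma b > 0" "Gamma (c - b) > 0" "Gamma c > 0"
    using assms by (auto intro!: Gamma_real_pos)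
  ultimately show ?thesis
    by (simp add: hyp2F1_def Beta_def mult.commute)
qed

section \<open>Three rational integrals\<close>

text \<open>
  The integration by parts behind the closed form: \<open>t * ((1-t) / D)^3\<close> vanishes at both
  endpoints, and its derivative is the difference of the two integrands. Here and below, exponents \<open>0\<close> and \<open>1\<close>
  are written out so that every integrand has the shape of Euler's integrand for integer parameters.
\<close>
lemma integral_by_parts_cube:
  fixes y :: real
  assumes "y > 0"
  shows "3 * y * integral {0..1} (\<lambda>t. (1 - t) ^ 2 * t ^ 1 / (1 - t + y * t) ^ 4)
       = integral {0..1} (\<lambda>t. (1 - t) ^ 3 * t ^ 0 / (1 - t + y * t) ^ 3)"
    (is "3 * y * integral _ ?f = integral _ ?g")
proof -
  define F where "F t = t * ((1 - t) / (1 - t + y * t)) ^ 3" for t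
  have "(F has_vector_derivative (?g t + (- 3 * y) * ?f t)) (at t within {0..1})"
    if t: "t \<in> {0..1}" for t
  proof -
    define D where "D = 1 - t + y * t"
    have D: "D > 0"
      using interpolation_pos[OF assms] t by (auto simp: D_def)
    have u: "((\<lambda>t. (1 - t) / (1 - t + y * t)) has_real_derivative - y / D ^ 2) (at t within {0..1})"
      by (rule derivative_eq_intros refl | use D in \<open>force simp: D_def\<close>)+
         (use D in \<open>simp add: D_def power2_eq_square divide_simps; simp add: algebra_simps\<close>)
    have "(F has_real_derivative ((1 - t) / D) ^ 3 + t * (3 * ((1 - t) / D) ^ 2 * (- y / D ^ 2)))
        (at t within {0..1})"
      unfolding F_def by (rule derivative_eq_intros refl u | simp add: D_def)+
    also have "((1 - t) / D) ^ 3 + t * (3 * ((1 - t) / D) ^ 2 * (- y / D ^ 2))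
        = (1 - t) ^ 3 / D ^ 3 - 3 * y * ((1 - t) ^ 2 * t / D ^ 4)"
      using D by (simp add: power_divide divide_simps)
    also have "\<dots> = ?g t + (- 3 * y) * ?f t"
      by (simp add: D_def)
    finally show ?thesis
      by (simp add: has_real_derivative_iff_has_vector_derivative)
  qed
  then have "((\<lambda>t. ?g t + (- 3 * y) * ?f t) has_integral (F 1 - F 0)) {0..1}"
    by (intro fundamental_theorem_of_calculus) auto
  then have "integral {0..1} (\<lambda>t. ?g t + (- 3 * y) * ?f t) = 0"
    by (simp add: F_def integral_unique)
  moreover have "integral {0..1} (\<lambda>t. ?g t + (- 3 * y) * ?f t)
      = integral {0..1} ?g + (- 3 * y) * integral {0..1} ?f"
    by (intro integral_add_scaled interpolant_integrable assms)
  ultimately show ?thesis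
    by simp
qed

lemma integral_reflect_cube:
  fixes y :: real
  assumes "y > 0"
  shows "integral {0..1} (\<lambda>t. (1 - t) ^ 3 * t ^ 0 / (1 - t + inverse y * t) ^ 3)
       = y ^ 3 * integral {0..1} (\<lambda>t. (1 - t) ^ 0 * t ^ 3 / (1 - t + y * t) ^ 3)"
    (is "integral _ ?f = _ * integral _ ?g")
proof -
  have "?f t = y ^ 3 * ?g (1 - t)" if t: "t \<in> {0..1}" for t
  proof -
    have "1 - t + inverse y * t = (1 - (1 - t) + y * (1 - t)) / y"
      using assms by (simp add: field_simps)
    then show ?thesis
      by (simp add: power_divide)
  qed
  then have "integral {0..1} ?f = integral {0..1} (\<lambda>t. y ^ 3 * ?g (1 - t))"
    by (intro integral_cong) auto
  also have "\<dots> = y ^ 3 * integral {0..1} (\<lambda>t. ?g (1 - t))"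
    by (rule integral_mult_right)
  also have "integral {0..1} (\<lambda>t. ?g (1 - t)) = integral {0..1} ?g"
  proof -
    have "(?g has_integral integral {0..1} ?g) (cbox 0 1)"
      using interpolant_integrable[OF assms, of 0 3 3] by (simp add: integrable_integral)
    from has_integral_affinity[OF this, of "-1" 1] show ?thesis
      by (intro integral_unique) (simp add: image_diff_atLeastAtMost)
  qed
  finally show ?thesis .
qed

text \<open>
  For \<open>y \<noteq> 1\<close> the combined numerator \<open>(1-t)^3 + y * t^3\<close>, written as a polynomial in \<open>D\<close>,
  has no \<open>D\<^sup>2\<close> term, so no logarithm arises. Integrating the remaining powers of \<open>D\<close> from \<open>t = 0\<close> and cancelling the
  powers of \<open>y - 1\<close> leaves the antiderivative \<open>F\<close> below, which is valid for \<open>y = 1\<close> too.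
\<close>
lemma integral_cubes:
  fixes y :: real
  assumes "y > 0"
  shows "integral {0..1} (\<lambda>t. (1 - t) ^ 3 * t ^ 0 / (1 - t + y * t) ^ 3)
       + y * integral {0..1} (\<lambda>t. (1 - t) ^ 0 * t ^ 3 / (1 - t + y * t) ^ 3) = 1 / (2 * y)"
    (is "integral _ ?f + y * integral _ ?g = _")
proof -
  define F where "F t = (2 * t + (y - 4) * t ^ 2 + 2 * t ^ 3) / (2 * (1 - t + y * t) ^ 2)" for t
  have "(F has_vector_derivative (?f t + y * ?g t)) (at t within {0..1})"
    if t: "t \<in> {0..1}" for t
  proof -
    define D where "D = 1 - t + y * t"
    have D: "D > 0"
      using interpolation_pos[OF assms] t by (auto simp: D_def)
    have "(F has_real_derivative ((2 + 2 * (y - 4) * t + 6 * t ^ 2) * (2 * D ^ 2)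
        - (2 * t + (y - 4) * t ^ 2 + 2 * t ^ 3) * (4 * D * (y - 1))) / (2 * D ^ 2 * (2 * D ^ 2)))
        (at t within {0..1})"
      unfolding F_def
      by (rule derivative_eq_intros refl | use D in \<open>force simp: D_def\<close>)+
         (use D in \<open>simp add: D_def power2_eq_square algebra_simps\<close>)
    also have "((2 + 2 * (y - 4) * t + 6 * t ^ 2) * (2 * D ^ 2)
        - (2 * t + (y - 4) * t ^ 2 + 2 * t ^ 3) * (4 * D * (y - 1))) / (2 * D ^ 2 * (2 * D ^ 2))
        = ((1 - t) ^ 3 + y * t ^ 3) / D ^ 3"
    proof -
      have "(2 + 2 * (y - 4) * t + 6 * t ^ 2) * D
          - (2 * t + (y - 4) * t ^ 2 + 2 * t ^ 3) * (2 * (y - 1)) = 2 * ((1 - t) ^ 3 + y * t ^ 3)"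
        unfolding D_def by algebra
      then have "((2 + 2 * (y - 4) * t + 6 * t ^ 2) * (2 * D ^ 2)
          - (2 * t + (y - 4) * t ^ 2 + 2 * t ^ 3) * (4 * D * (y - 1))) * D ^ 3
          = ((1 - t) ^ 3 + y * t ^ 3) * (2 * D ^ 2 * (2 * D ^ 2))"
        by algebra
      then show ?thesis
        using D by (subst frac_eq_eq) auto
    qed
    also have "\<dots> = ?f t + y * ?g t"
      by (simp add: D_def add_divide_distrib)
    finally show ?thesis
      by (simp add: has_real_derivative_iff_has_vector_derivative)
  qed
  then have "((\<lambda>t. ?f t + y * ?g t) has_integral (F 1 - F 0)) {0..1}"
    by (intro fundamental_theorem_of_calculus) auto
  then have "integral {0..1} (\<lambda>t. ?f t + y * ?g t) = F 1 - F 0"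
    by (rule integral_unique)
  moreover have "F 1 - F 0 = 1 / (2 * y)"
    using assms by (simp add: F_def power2_eq_square)
  moreover have "integral {0..1} (\<lambda>t. ?f t + y * ?g t)
      = integral {0..1} ?f + y * integral {0..1} ?g"
    by (intro integral_add_scaled interpolant_integrable assms)
  ultimately show ?thesis
    by simp
qed

section \<open>The closed form and the functional equation\<close>

lemma K_Delta_2_one: "K_Delta_2 1 = 1/6"
  by (simp add: K_Delta_2_def hyp2F1_zero)

lemma hyp2F1_3_1_5:
  fixes y :: real
  assumes "y > 0"
  shows "hyp2F1 3 1 5 (1 - y) =
    4 * integral {0..1} (\<lambda>t. (1 - t) ^ 3 * t ^ 0 / (1 - t + y * t) ^ 3)"
  using hyp2F1_one_minus_eq_integral[OF assms, of 3 0 3] by (simp add: fact_numeral)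

lemma T_closed_form:
  fixes y :: real
  assumes "y > 0"
  shows "T y = 1/6 * (inverse y - hyp2F1 3 1 5 (1 - y))"
proof -
  define I where "I m n a = integral {0..1} (\<lambda>t. (1 - t) ^ m * t ^ n / (1 - t + y * t) ^ a)"
    for m n a :: nat
  have F314: "hyp2F1 3 1 4 (1 - y) = 3 * I 2 0 3"
    using hyp2F1_one_minus_eq_integral[OF assms, of 3 0 2] by (simp add: fact_numeral I_def)
  have F415: "hyp2F1 4 1 5 (1 - y) = 4 * I 3 0 4"
    using hyp2F1_one_minus_eq_integral[OF assms, of 4 0 3] by (simp add: fact_numeral I_def)
  have F425: "hyp2F1 4 2 5 (1 - y) = 12 * I 2 1 4"
    using hyp2F1_one_minus_eq_integral[OF assms, of 4 1 2] by (simp add: fact_numeral I_def)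
  have F315: "hyp2F1 3 1 5 (1 - y) = 4 * I 3 0 3"
    using hyp2F1_3_1_5[OF assms] by (simp add: I_def)
  have split: "I 2 0 3 = I 3 0 4 + y * I 2 1 4"
  proof -
    have "(1 - t) ^ 2 * t ^ 0 / (1 - t + y * t) ^ 3
        = (1 - t) ^ 3 * t ^ 0 / (1 - t + y * t) ^ 4
          + y * ((1 - t) ^ 2 * t ^ 1 / (1 - t + y * t) ^ 4)"
      if t: "t \<in> {0..1}" for t
    proof -
      define D where "D = 1 - t + y * t"
      have D: "D > 0"
        using interpolation_pos[OF assms] t by (auto simp: D_def)
      have "(1 - t) ^ 2 / D ^ 3 = (1 - t) ^ 2 * D / D ^ 4"
        using D by (simp add: eval_nat_numeral)
      also have "(1 - t) ^ 2 * D = (1 - t) ^ 3 + y * ((1 - t) ^ 2 * t)"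
        unfolding D_def by algebra
      finally show ?thesis
        by (simp add: D_def add_divide_distrib)
    qed
    then have "I 2 0 3 = integral {0..1} (\<lambda>t. (1 - t) ^ 3 * t ^ 0 / (1 - t + y * t) ^ 4
          + y * ((1 - t) ^ 2 * t ^ 1 / (1 - t + y * t) ^ 4))"
      unfolding I_def by (intro integral_cong)
    also have "\<dots> = I 3 0 4 + y * I 2 1 4"
      unfolding I_def by (intro integral_add_scaled interpolant_integrable assms)
    finally show ?thesis .
  qed
  have parts: "3 * y * I 2 1 4 = I 3 0 3"
    using integral_by_parts_cube[OF assms] by (simp add: I_def)
  show ?thesis
    unfolding T_def F314 F415 F425 F315 split parts[symmetric]
    by (simp add: field_simps)
qed

lemma T_functional_equation:
  fixes y :: real
  assumes "y > 0"
  shows "T y + inverse (y ^ 2) * T (inverse y) = 0"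
proof -
  define A where "A = integral {0..1} (\<lambda>t. (1 - t) ^ 3 * t ^ 0 / (1 - t + y * t) ^ 3)"
  define B where "B = integral {0..1} (\<lambda>t. (1 - t) ^ 0 * t ^ 3 / (1 - t + y * t) ^ 3)"
  have "T y = 1/6 * (inverse y - 4 * A)"
    using T_closed_form[OF assms] hyp2F1_3_1_5[OF assms] by (simp only: A_def)
  moreover have "T (inverse y) = 1/6 * (y - 4 * (y ^ 3 * B))"
    using T_closed_form[of "inverse y"] hyp2F1_3_1_5[of "inverse y"]
      integral_reflect_cube[OF assms] assms
    by (simp only: B_def inverse_inverse_eq positive_imp_inverse_positive)
  moreover have "A = 1 / (2 * y) - y * B"
    using integral_cubes[OF assms] by (simp only: A_def B_def)
  ultimately have "T y + inverse (y ^ 2) * T (inverse y)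
      = 1/6 * (inverse y - 4 * (1 / (2 * y) - y * B)) + inverse (y ^ 2) * (1/6 * (y - 4 * (y ^ 3 * B)))"
    by (simp only:)
  also have "\<dots> = 0"
    using assms by (simp add: field_simps eval_nat_numeral)
  finally show ?thesis .
qed

theorem proposition5p2:
  fixes y :: real
  assumes "y > 0"
  shows "K_Delta_2 1 = 1/6 \<and>
         T y = K_Delta_2 1 * (inverse y - hyp2F1 3 1 5 (1 - y)) \<and>
         T y + inverse (y ^ 2) * T (inverse y) = 0"
  unfolding K_Delta_2_one
  using T_closed_form[OF assms] T_functional_equation[OF assms] by blast

end
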